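(* Let $K\subset L$ be commutative fields such that every element of $L$ that is algebraic over $K$ is separable over $K$. Let $A,B,C$ be finite-dimensional $K$-subspaces of $L$ with $A\neq\{0\}$, $B\neq\{0\}$ and $K\subset C$. Then either $\langle ABC\rangle=\langle AB\rangle$ or $\dim_K\langle ABC\rangle\geq\dim_KA+\dim_KB$.
   Context: For $S\subset L$, $\langle S\rangle$ denotes the $K$-subspace of $L$ spanned by $S$. Product sets: $AB=\{ab\mid a\in A,b\in B\}$, $ABC=\{abc\mid a\in A,b\in B,c\in C\}$. *)

theory Defs
  imports "HOL-Computational_Algebra.Polynomial"
begin

text \<open>A (necessarily injective) homomorphism of fields; it realises the
  field K (a type 'k) as a subfield of L (a type 'a).\<close>
definition field_hom :: "('k::field \<Rightarrow> 'a::field) \<Rightarrow> bool" where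
  "field_hom f \<longleftrightarrow> f 1 = 1 \<and> (\<forall>x y. f (x + y) = f x + f y) \<and> (\<forall>x y. f (x * y) = f x * f y)"

definition kscale :: "('k::field \<Rightarrow> 'a::field) \<Rightarrow> 'k \<Rightarrow> 'a \<Rightarrow> 'a" where
  "kscale f c x = f c * x"

definition algebraic_over :: "('k::field \<Rightarrow> 'a::field) \<Rightarrow> 'a \<Rightarrow> bool" where
  "algebraic_over f x \<longleftrightarrow> (\<exists>p::'k poly. p \<noteq> 0 \<and> poly (map_poly f p) x = 0)"

definition min_poly_over :: "('k::field \<Rightarrow> 'a::field) \<Rightarrow> 'a \<Rightarrow> 'k poly" where
  "min_poly_over f x = (THE p. p \<noteq> 0 \<and> lead_coeff p = 1 \<and> poly (map_poly f p) x = 0 \<and>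
      (\<forall>q. q \<noteq> 0 \<and> poly (map_poly f q) x = 0 \<longrightarrow> degree p \<le> degree q))"

definition separable_over :: "('k::field \<Rightarrow> 'a::field) \<Rightarrow> 'a \<Rightarrow> bool" where
  "separable_over f x \<longleftrightarrow> algebraic_over f x \<and>
     coprime (min_poly_over f x) (pderiv (min_poly_over f x))"

definition setprod2 :: "'a::field set \<Rightarrow> 'a set \<Rightarrow> 'a set" where
  "setprod2 A B = {a * b | a b. a \<in> A \<and> b \<in> B}"

definition setprod3 :: "'a::field set \<Rightarrow> 'a set \<Rightarrow> 'a set \<Rightarrow> 'a set" where
  "setprod3 A B C = {a * b * c | a b c. a \<in> A \<and> b \<in> B \<and> c \<in> C}"

end

theory Submission
  imports Defs
begin

text \<open>
  If \<open>\<langle>ABC\<rangle> \<noteq> \<langle>AB\<rangle>\<close>, some \<open>a \<in> A\<close>, \<open>b \<in> B\<close>, \<open>c \<in> C\<close> satisfy \<open>a b c \<notin> \<langle>AB\<rangle>\<close>, and dividing \<open>A\<close> by \<open>a\<close>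
  we may take \<open>a = 1\<close>. For \<open>0 \<noteq> e \<in> B\<close>, Dyson's transform \<open>A \<inter> e\<^sup>-\<^sup>1 B\<close>, \<open>B + e A\<close> keeps \<open>1\<close> in
  the first space, enlarges the second, preserves the sum of the dimensions and does not enlarge
  \<open>\<langle>AB\<rangle>\<close>. When no transform shrinks \<open>A\<close> any more, \<open>A B \<subseteq> B\<close>, so \<open>A\<close> lies in the stabilizer of \<open>B\<close>.
  Hence there is \<open>V\<close> with \<open>B \<subseteq> V \<subseteq> \<langle>AB\<rangle>\<close> and \<open>dim V + dim H \<ge> dim A + dim B\<close>, where \<open>H\<close> is the
  stabilizer of \<open>V\<close>. As \<open>H\<close> is a field and \<open>b c \<notin> V\<close>, the sum \<open>V + b c H\<close> is direct, and it is
  contained in \<open>\<langle>ABC\<rangle>\<close>.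
\<close>

section \<open>Dimensions of finite-dimensional subsets\<close>

text \<open>
  A copy of the locale \<^locale>\<open>vector_space\<close>: there, new names would be captured by the global
  interpretation for real vector spaces.
\<close>
locale linear_space = vector_space scale
  for scale :: "'k::field \<Rightarrow> 'b::ab_group_add \<Rightarrow> 'b"
begin

text \<open>The ambient space may be infinite-dimensional, and \<open>dim\<close> is 0 for a set
  whose span has only infinite bases; dimension comparisons therefore carry this finiteness
  condition.\<close>

definition fin_dim :: "'b set \<Rightarrow> bool" where
  "fin_dim S \<longleftrightarrow> (\<exists>T. finite T \<and> S \<subseteq> span T)"

lemma fin_dim_subset: "S \<subseteq> T \<Longrightarrow> fin_dim T \<Longrightarrow> fin_dim S"
  unfolding fin_dim_def by blast

lemma fin_dim_span: "fin_dim S \<Longrightarrow> fin_dim (span S)"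
  unfolding fin_dim_def by (meson span_minimal subspace_span)

lemma fin_dim_Un:
  assumes "fin_dim S" "fin_dim T"
  shows "fin_dim (S \<union> T)"
proof -
  obtain X Y where "finite X" "S \<subseteq> span X" "finite Y" "T \<subseteq> span Y"
    using assms unfolding fin_dim_def by blast
  then have "finite (X \<union> Y)" "S \<union> T \<subseteq> span (X \<union> Y)"
    using span_mono[of X "X \<union> Y"] span_mono[of Y "X \<union> Y"] by auto
  then show ?thesis
    unfolding fin_dim_def by blast
qed

lemma finite_independent_subset:
  assumes "fin_dim S" "independent b" "b \<subseteq> S"
  shows "finite b"
  using assms independent_span_bound unfolding fin_dim_def by blast

lemma dim_mono_fin_dim:
  assumes "S \<subseteq> T" "fin_dim T"
  shows "dim S \<le> dim T"
proof -
  obtain b where b: "b \<subseteq> T" "independent b" "T \<subseteq> span b" "card b = dim T"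
    by (rule basis_exists)
  then show ?thesis
    using dim_le_card[of S b] assms finite_independent_subset by auto
qed

text \<open>A vector of \<open>T\<close> outside \<open>S\<close> would extend a basis of
  \<open>S\<close> to an independent subset of \<open>T\<close> with \<open>dim S + 1\<close>
  elements.\<close>

lemma subspace_eq_if_dim_ge:
  assumes "subspace S" "S \<subseteq> T" "fin_dim T" "dim T \<le> dim S"
  shows "S = T"
proof (rule ccontr)
  assume "S \<noteq> T"
  then obtain x where x: "x \<in> T" "x \<notin> S" using assms by blast
  obtain b where b: "b \<subseteq> S" "independent b" "S \<subseteq> span b" "card b = dim S"
    by (rule basis_exists)
  have "x \<notin> span b" using span_minimal[OF b(1) assms(1)] x by blast
  then have ind: "independent (insert x b)"
    using independent_insertI b by blast
  have sub: "insert x b \<subseteq> T" using x b assms by blast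
  have "card (insert x b) \<le> dim T"
    using dim_mono_fin_dim[OF sub assms(3)] dim_eq_card_independent[OF ind] by simp
  moreover have "x \<notin> b" using b x by blast
  moreover have "finite b"
    using finite_independent_subset[OF assms(3) ind sub] by simp
  ultimately show False using b assms(4) by simp
qed

text \<open>One half of Grassmann's dimension formula: a basis \<open>D\<close> of the intersection
  extends to bases \<open>E\<close> of \<open>S\<close> and \<open>F\<close> of \<open>T\<close>,
  and \<open>E \<union> F\<close> is still independent.\<close>

lemma dim_plus_dim_le:
  assumes S: "subspace S" "fin_dim S" and T: "subspace T" "fin_dim T"
  shows "dim S + dim T \<le> dim (span (S \<union> T)) + dim (S \<inter> T)"
proof -
  obtain D where D: "D \<subseteq> S \<inter> T" "independent D" "S \<inter> T \<subseteq> span D" "card D = dim (S \<inter> T)"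
    by (rule basis_exists)
  obtain E where E: "D \<subseteq> E" "E \<subseteq> S" "independent E" "S \<subseteq> span E"
    using maximal_independent_subset_extend[of D S] D by auto
  obtain F where F: "D \<subseteq> F" "F \<subseteq> T" "independent F" "T \<subseteq> span F"
    using maximal_independent_subset_extend[of D T] D by auto
  have fin: "finite E" "finite F"
    using finite_independent_subset S T E F by blast+
  have spanE: "span E = S" using E S by (simp add: span_subspace)
  have "independent (E \<union> G) \<and> E \<inter> G = {}" if "finite G" "G \<subseteq> F - D" for G
    using that
  proof (induction G rule: finite_induct)
    case empty
    then show ?case using E by simp
  next
    case (insert g G)
    \<comment> \<open>In a relation \<open>g = s + t\<close>, the part \<open>s = g - t\<close> lies
      in both \<open>S\<close> and \<open>T\<close>, hence in \<open>span D\<close>; then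
      \<open>g\<close> would depend on the other elements of \<open>F\<close>.\<close>
    have "g \<notin> span (E \<union> G)"
    proof
      assume "g \<in> span (E \<union> G)"
      then obtain s t where st: "g = s + t" "s \<in> S" "t \<in> span G"
        unfolding span_Un spanE by blast
      have "t \<in> T"
        using st(3) span_minimal[of G T] insert.prems F T by blast
      moreover have "g \<in> T" using insert.prems F by blast
      ultimately have "s \<in> T"
        using st(1) T subspace_diff[of T g t] by simp
      then have "s \<in> span D" using st D by blast
      then have "g \<in> span (D \<union> G)"
        using st unfolding span_Un by blast
      then have "g \<in> span (F - {g})"
        using span_mono[of "D \<union> G" "F - {g}"] insert F by blast
      then show False
        using F insert.prems unfolding dependent_def by blast
    qed
    then show ?case
      using insert independent_insertI span_base[of g "E \<union> G"] by auto
  qed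
  from this[of "F - D"] have ind: "independent (E \<union> (F - D))" "E \<inter> (F - D) = {}"
    using fin by auto
  have "card (E \<union> (F - D)) = card E + card (F - D)"
    using fin ind by (simp add: card_Un_disjoint)
  moreover have "card (F - D) + card D = card F"
    using F fin by (simp add: card_Diff_subset card_mono finite_subset)
  moreover have "card E = dim S" "card F = dim T"
    using E F basis_card_eq_dim by blast+
  moreover have "card (E \<union> (F - D)) \<le> dim (span (S \<union> T))"
  proof -
    have "E \<union> (F - D) \<subseteq> span (S \<union> T)"
      using E F span_superset[of "S \<union> T"] by blast
    then show ?thesis
      using dim_mono_fin_dim fin_dim_span fin_dim_Un S T dim_eq_card_independent[OF ind(1)]
      by metis
  qed
  ultimately show ?thesis using D by linarith
qed

end

section \<open>Multiplication maps and product sets in a field extension\<close>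

locale field_extension =
  fixes f :: "'k::field \<Rightarrow> 'a::field"
  assumes hom: "field_hom f"
begin

sublocale linear_space "kscale f"
  using hom by unfold_locales (auto simp: kscale_def field_hom_def algebra_simps)

sublocale mult_map: Vector_Spaces.linear "kscale f" "kscale f" "(*) a" for a
  by unfold_locales (auto simp: kscale_def algebra_simps)

lemma dim_mult_image:
  assumes "a \<noteq> 0"
  shows "dim ((*) a ` S) = dim S"
proof -
  obtain b where b: "b \<subseteq> S" "independent b" "S \<subseteq> span b" "card b = dim S"
    by (rule basis_exists)
  have inj: "inj_on ((*) a) X" for X
    using assms by (simp add: inj_on_def)
  have "dim ((*) a ` S) = card ((*) a ` b)"
    using b(3) mult_map.spans_image mult_map.independent_injective_image[OF b(2) inj]
    by (intro basis_card_eq_dim[symmetric] image_mono b(1)) auto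
  then show ?thesis using b card_image[OF inj] by simp
qed

lemma fin_dim_mult_image: "fin_dim S \<Longrightarrow> fin_dim ((*) a ` S)"
  unfolding fin_dim_def by (meson finite_imageI mult_map.spans_image)

lemma setprod3_eq: "setprod3 A B C = setprod2 (setprod2 A B) C"
  unfolding setprod2_def setprod3_def by blast

lemma setprod2_mult_image: "setprod2 ((*) a ` A) B = (*) a ` setprod2 A B"
proof -
  have "setprod2 ((*) a ` A) B = {a * x * y | x y. x \<in> A \<and> y \<in> B}"
    unfolding setprod2_def by blast
  also have "\<dots> = (*) a ` setprod2 A B"
    unfolding setprod2_def mult.assoc by blast
  finally show ?thesis .
qed

lemma setprod3_mult_image: "setprod3 ((*) a ` A) B C = (*) a ` setprod3 A B C"
  by (simp add: setprod3_eq setprod2_mult_image)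

text \<open>Bilinearity, one factor at a time: first \<open>x\<close> is fixed in \<open>X\<close>
  and \<open>y\<close> ranges over \<open>span Y\<close>, then such a \<open>y\<close> is fixed and
  \<open>x\<close> ranges over \<open>span X\<close>.\<close>

lemma setprod2_span_subset:
  "setprod2 (span X) (span Y) \<subseteq> span (setprod2 X Y)"
proof -
  have "x * y \<in> span (setprod2 X Y)" if "x \<in> X" "y \<in> span Y" for x y
  proof -
    have "x * y \<in> (*) x ` span Y" using that by blast
    also have "\<dots> = span ((*) x ` Y)" by (simp add: mult_map.span_image)
    also have "\<dots> \<subseteq> span (setprod2 X Y)"
      using that by (intro span_mono) (auto simp: setprod2_def)
    finally show ?thesis .
  qed
  then have *: "(*) y ` X \<subseteq> span (setprod2 X Y)" if "y \<in> span Y" for y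
    using that by (auto simp: mult.commute)
  have "x * y \<in> span (setprod2 X Y)" if "x \<in> span X" "y \<in> span Y" for x y
  proof -
    have "y * x \<in> span ((*) y ` X)" unfolding mult_map.span_image using that by blast
    also have "\<dots> \<subseteq> span (setprod2 X Y)"
      using span_minimal[OF *] that by simp
    finally show ?thesis by (simp only: mult.commute)
  qed
  then show ?thesis by (auto simp: setprod2_def)
qed

lemma fin_dim_setprod2:
  assumes "fin_dim A" "fin_dim B"
  shows "fin_dim (setprod2 A B)"
proof -
  obtain X Y where XY: "finite X" "A \<subseteq> span X" "finite Y" "B \<subseteq> span Y"
    using assms unfolding fin_dim_def by blast
  have "setprod2 X Y = (\<lambda>(x, y). x * y) ` (X \<times> Y)"
    by (auto simp: setprod2_def)
  then have "finite (setprod2 X Y)" using XY by simp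
  moreover have "setprod2 A B \<subseteq> setprod2 (span X) (span Y)"
    using XY unfolding setprod2_def by blast
  ultimately show ?thesis
    using setprod2_span_subset unfolding fin_dim_def by blast
qed

section \<open>Stabilizers of subspaces\<close>

definition stabilizer :: "'a set \<Rightarrow> 'a set" where
  "stabilizer V = {h. \<forall>v\<in>V. h * v \<in> V}"

lemma subspace_stabilizer:
  assumes "subspace V"
  shows "subspace (stabilizer V)"
proof (rule subspaceI)
  show "0 \<in> stabilizer V"
    using subspace_0[OF assms] by (simp add: stabilizer_def)
  show "x + y \<in> stabilizer V" if "x \<in> stabilizer V" "y \<in> stabilizer V" for x y
    using that subspace_add[OF assms] by (simp add: stabilizer_def distrib_right)
  show "kscale f c x \<in> stabilizer V" if "x \<in> stabilizer V" for c x
    using that subspace_scale[OF assms, of _ c] by (simp add: stabilizer_def kscale_def mult.assoc)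
qed

text \<open>Multiplication by \<open>v\<close> embeds the stabilizer into \<open>V\<close>.\<close>

lemma fin_dim_stabilizer:
  assumes "fin_dim V" "v \<in> V" "v \<noteq> 0"
  shows "fin_dim (stabilizer V)"
proof -
  have "stabilizer V \<subseteq> (*) (inverse v) ` V"
  proof
    fix h assume "h \<in> stabilizer V"
    then have "h * v \<in> V" using assms by (simp add: stabilizer_def)
    then show "h \<in> (*) (inverse v) ` V"
      using assms(3) by (auto intro!: image_eqI[of _ _ "h * v"])
  qed
  then show ?thesis
    using assms fin_dim_mult_image fin_dim_subset by blast
qed

text \<open>Multiplication by \<open>h\<close> is an injective linear map from \<open>V\<close> into
  itself, so it is onto because \<open>V\<close> has finite dimension.\<close>

lemma stabilizer_inverse:
  assumes V: "subspace V" "fin_dim V" and h: "h \<in> stabilizer V" "h \<noteq> 0"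
  shows "inverse h \<in> stabilizer V"
proof -
  have "(*) h ` V = V"
    using V h dim_mult_image[of h V] mult_map.subspace_image[of V h]
    by (intro subspace_eq_if_dim_ge) (auto simp: stabilizer_def)
  then have "\<exists>w\<in>V. v = h * w" if "v \<in> V" for v
    using that by blast
  then show ?thesis
    using h unfolding stabilizer_def by (fastforce simp flip: mult.assoc)
qed

section \<open>Dyson's transform and its iteration\<close>

lemma Dyson_transform:
  fixes A B :: "'a set" and e :: 'a
  assumes A: "subspace A" "fin_dim A" and B: "subspace B" "fin_dim B" and e: "e \<noteq> 0"
  defines "A' \<equiv> A \<inter> (*) (inverse e) ` B" and "B' \<equiv> span ((*) e ` A \<union> B)"
  shows "dim A + dim B \<le> dim A' + dim B'"
    and "span (setprod2 A' B') \<subseteq> span (setprod2 A B)"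
proof -
  \<comment> \<open>Up to the factor \<open>e\<close>, the pair \<open>A'\<close>, \<open>B'\<close>
    is the intersection and the sum of \<open>e A\<close> and \<open>B\<close>, so the dimension
    formula applies.\<close>
  have img: "(*) e ` A' = (*) e ` A \<inter> B"
    using e unfolding A'_def by (force simp: image_iff field_simps)
  have "dim ((*) e ` A) + dim B \<le> dim B' + dim ((*) e ` A \<inter> B)"
    unfolding B'_def using A B mult_map.subspace_image fin_dim_mult_image
    by (intro dim_plus_dim_le) auto
  then show "dim A + dim B \<le> dim A' + dim B'"
    using dim_mult_image[OF e, of A] dim_mult_image[OF e, of A'] img by simp
  have "setprod2 A' ((*) e ` A \<union> B) \<subseteq> setprod2 A B"
  proof
    fix z assume "z \<in> setprod2 A' ((*) e ` A \<union> B)"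
    then obtain x y where z: "z = x * y" "x \<in> A'" "y \<in> (*) e ` A \<union> B"
      by (auto simp: setprod2_def)
    from z(3) show "z \<in> setprod2 A B"
    proof
      assume "y \<in> B"
      then show ?thesis using z unfolding A'_def setprod2_def by blast
    next
      assume "y \<in> (*) e ` A"
      then obtain u where u: "u \<in> A" "y = e * u" by blast
      \<comment> \<open>The factors trade places: \<open>inverse e * w\<close> times
        \<open>e * u\<close> is \<open>u * w\<close>, with \<open>u\<close> from \<open>A\<close>
        and \<open>w\<close> from \<open>B\<close>.\<close>
      obtain w where w: "w \<in> B" "x = inverse e * w" using z unfolding A'_def by blast
      have "z = u * w" using z u w e by simp
      then show ?thesis using u w unfolding setprod2_def by blast
    qed
  qed
  moreover have "setprod2 A' B' \<subseteq> span (setprod2 A' ((*) e ` A \<union> B))"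
    unfolding B'_def using setprod2_span_subset[of A' "(*) e ` A \<union> B"] span_superset[of A']
    unfolding setprod2_def by blast
  ultimately show "span (setprod2 A' B') \<subseteq> span (setprod2 A B)"
    by (meson span_minimal span_mono subset_trans subspace_span)
qed

lemma exists_stable_subspace:
  assumes "subspace A" "fin_dim A" "1 \<in> A" "subspace B" "fin_dim B" "B \<noteq> {0}"
  shows "\<exists>V. subspace V \<and> B \<subseteq> V \<and> V \<subseteq> span (setprod2 A B) \<and>
           dim A + dim B \<le> dim V + dim (stabilizer V)"
  using assms
proof (induction "dim A" arbitrary: A B rule: less_induct)
  case less
  show ?case
  proof (cases "setprod2 A B \<subseteq> B")
    case True
    have "A \<subseteq> stabilizer B"
      using True unfolding setprod2_def stabilizer_def by blast
    moreover obtain v where "v \<in> B" "v \<noteq> 0"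
      using less.prems subspace_0 by blast
    ultimately have "dim A \<le> dim (stabilizer B)"
      using dim_mono_fin_dim fin_dim_stabilizer less.prems by blast
    \<comment> \<open>This containment rests on \<open>1 \<in> A\<close>, which is why the induction
      must preserve it.\<close>
    moreover have "B \<subseteq> setprod2 A B"
      using less.prems(3) unfolding setprod2_def by force
    ultimately show ?thesis
      using less.prems span_superset[of "setprod2 A B"] by (intro exI[of _ B]) auto
  next
    case False
    then obtain a e where ae: "a \<in> A" "e \<in> B" "a * e \<notin> B"
      unfolding setprod2_def by blast
    have e: "e \<noteq> 0" using ae less.prems subspace_0 by auto
    define A' where "A' = A \<inter> (*) (inverse e) ` B"
    define B' where "B' = span ((*) e ` A \<union> B)"
    note dyson = Dyson_transform[OF less.prems(1,2,4,5) e, folded A'_def B'_def]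
    have A': "subspace A'" "A' \<subseteq> A"
      unfolding A'_def using less.prems mult_map.subspace_image subspace_inter by auto
    \<comment> \<open>The pair \<open>a\<close>, \<open>e\<close> witnesses that \<open>A B\<close>
      is not inside \<open>B\<close>; choosing this \<open>e\<close> for the transform removes
      \<open>a\<close> from \<open>A\<close>, so the dimension drops.\<close>
    have "a \<notin> A'"
      using ae e by (auto simp: A'_def field_simps)
    then have "dim A' < dim A"
      using subspace_eq_if_dim_ge[OF A' less.prems(2)] ae by fastforce
    \<comment> \<open>Here \<open>1 = inverse e * e\<close> with \<open>e \<in> B\<close>.\<close>
    moreover have "1 \<in> A'"
      using less.prems ae e by (auto simp: A'_def intro!: image_eqI[of _ _ e])
    moreover have BB': "B \<subseteq> B'"
      unfolding B'_def using span_superset by blast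
    moreover have "B' \<noteq> {0}" using BB' ae e by blast
    moreover have "fin_dim B'"
      unfolding B'_def using less.prems fin_dim_span fin_dim_Un fin_dim_mult_image by blast
    moreover have "subspace B'" unfolding B'_def by simp
    ultimately obtain V where V: "subspace V" "B' \<subseteq> V" "V \<subseteq> span (setprod2 A' B')"
      "dim A' + dim B' \<le> dim V + dim (stabilizer V)"
      using less.hyps[of A' B'] A' fin_dim_subset less.prems(2) by blast
    then show ?thesis
      using dyson BB' by (intro exI[of _ V]) auto
  qed
qed

section \<open>The lower bound and the reduction to \<open>1 \<in> A\<close>\<close>

lemma dim_setprod3_ge:
  assumes A: "subspace A" "fin_dim A" "1 \<in> A" and B: "subspace B" "fin_dim B"
    and C: "1 \<in> C" "fin_dim C" and bc: "b \<in> B" "c \<in> C" "b * c \<notin> span (setprod2 A B)"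
  shows "dim A + dim B \<le> dim (span (setprod3 A B C))"
proof -
  have nz: "b * c \<noteq> 0" using bc(3) span_zero by metis
  then have b: "b \<noteq> 0" by simp
  then have "B \<noteq> {0}" using bc by blast
  then obtain V where V: "subspace V" "B \<subseteq> V" "V \<subseteq> span (setprod2 A B)"
      "dim A + dim B \<le> dim V + dim (stabilizer V)"
    using exists_stable_subspace A B by blast
  define W where "W = (*) (b * c) ` stabilizer V"
  have finV: "fin_dim V"
    using V A B fin_dim_setprod2 fin_dim_span fin_dim_subset by blast
  have H: "subspace (stabilizer V)" "fin_dim (stabilizer V)"
    using subspace_stabilizer[OF V(1)] fin_dim_stabilizer[OF finV _ b] bc V by auto
  have W: "subspace W" "fin_dim W" "dim W = dim (stabilizer V)"
    unfolding W_def using H mult_map.subspace_image fin_dim_mult_image dim_mult_image[OF nz] by auto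
  \<comment> \<open>If \<open>b * c * h\<close> with \<open>h \<noteq> 0\<close> were in
    \<open>V\<close>, multiplying by \<open>inverse h\<close> would put \<open>b * c\<close> into
    \<open>V\<close>, hence into \<open>span (setprod2 A B)\<close>.\<close>
  have "V \<inter> W \<subseteq> {0}"
  proof
    fix x assume x: "x \<in> V \<inter> W"
    then obtain h where h: "h \<in> stabilizer V" "x = b * c * h" unfolding W_def by blast
    have "h = 0"
    proof (rule ccontr)
      assume "h \<noteq> 0"
      then have "inverse h * x \<in> V"
        using stabilizer_inverse[OF V(1) finV h(1)] x by (simp add: stabilizer_def)
      then show False using \<open>h \<noteq> 0\<close> h V(3) bc(3) by (auto simp: field_simps)
    qed
    then show "x \<in> {0}" using h by simp
  qed
  then have "dim (V \<inter> W) = 0"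
    using dim_le_card[of "V \<inter> W" "{}"] by simp
  then have "dim V + dim (stabilizer V) \<le> dim (span (V \<union> W))"
    using dim_plus_dim_le[OF V(1) finV W(1,2)] W(3) by simp
  also have "\<dots> \<le> dim (span (setprod3 A B C))"
  proof (rule dim_mono_fin_dim)
    show "fin_dim (span (setprod3 A B C))"
      unfolding setprod3_eq using A B C fin_dim_setprod2 fin_dim_span by blast
    have AB_C: "x * y \<in> span (setprod3 A B C)" if "x \<in> span (setprod2 A B)" "y \<in> C" for x y
      unfolding setprod3_eq using setprod2_span_subset[of "setprod2 A B" C] that span_base[of y C]
      unfolding setprod2_def by blast
    have "V \<subseteq> span (setprod3 A B C)"
      using AB_C[OF _ C(1)] V(3) by auto
    moreover have "W \<subseteq> span (setprod3 A B C)"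
    proof
      fix x assume "x \<in> W"
      then obtain h where h: "h \<in> stabilizer V" "x = h * b * c"
        unfolding W_def by (auto simp: ac_simps)
      \<comment> \<open>As \<open>b \<in> B \<subseteq> V\<close>, the stabilizing element
        \<open>h\<close> keeps \<open>h * b\<close> inside \<open>V\<close>; the factor
        \<open>c\<close> then leads into the triple product.\<close>
      then have "h * b \<in> span (setprod2 A B)"
        using V bc unfolding stabilizer_def by blast
      then show "x \<in> span (setprod3 A B C)" using AB_C bc h by blast
    qed
    ultimately show "span (V \<union> W) \<subseteq> span (setprod3 A B C)"
      by (intro span_minimal) auto
  qed
  finally show ?thesis using V(4) by linarith
qed

end

theorem mainTheorem11:
  fixes f :: "'k::field \<Rightarrow> 'a::field"
    and A B C :: "'a set"
  assumes hom: "field_hom f"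
    and sep: "\<forall>x. algebraic_over f x \<longrightarrow> separable_over f x"
    and A: "module.subspace (kscale f) A" "\<exists>S. finite S \<and> module.span (kscale f) S = A"
    and B: "module.subspace (kscale f) B" "\<exists>S. finite S \<and> module.span (kscale f) S = B"
    and C: "module.subspace (kscale f) C" "\<exists>S. finite S \<and> module.span (kscale f) S = C"
    and A0: "A \<noteq> {0}" and B0: "B \<noteq> {0}"
    and KC: "range f \<subseteq> C"
  shows "module.span (kscale f) (setprod3 A B C) = module.span (kscale f) (setprod2 A B)
         \<or> vector_space.dim (kscale f) (module.span (kscale f) (setprod3 A B C))
             \<ge> vector_space.dim (kscale f) A + vector_space.dim (kscale f) B"
proof -
  interpret field_extension f by unfold_locales (fact hom)
  have fin: "fin_dim A" "fin_dim B" "fin_dim C"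
    using A B C unfolding fin_dim_def by blast+
  have C1: "1 \<in> C" using hom KC unfolding field_hom_def by (metis rangeI subsetD)
  show ?thesis
  proof (cases "setprod3 A B C \<subseteq> span (setprod2 A B)")
    case True
    moreover have "setprod2 A B \<subseteq> setprod3 A B C"
      using C1 unfolding setprod2_def setprod3_def by force
    ultimately show ?thesis
      using span_mono span_minimal[OF True] by blast
  next
    case False
    then obtain a b c where abc: "a \<in> A" "b \<in> B" "c \<in> C" "a * b * c \<notin> span (setprod2 A B)"
      unfolding setprod3_def by blast
    have a: "a \<noteq> 0" using abc(4) span_zero by auto
    then have inv: "inverse a \<noteq> 0" by simp
    \<comment> \<open>Dividing by \<open>a\<close> scales both product spans by the same nonzero
      factor, so non-membership and all dimensions carry over.\<close>
    define A' where "A' = (*) (inverse a) ` A"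
    have "b * c \<notin> span (setprod2 A' B)"
      using abc(4) a unfolding A'_def setprod2_mult_image mult_map.span_image
      by (auto simp: field_simps)
    moreover have "1 \<in> A'"
      using abc a unfolding A'_def by (auto intro!: image_eqI[of _ _ a])
    moreover have "subspace A'" "fin_dim A'"
      unfolding A'_def using A fin mult_map.subspace_image fin_dim_mult_image by auto
    ultimately have "dim A' + dim B \<le> dim (span (setprod3 A' B C))"
      using dim_setprod3_ge B fin C1 abc by blast
    then show ?thesis
      unfolding A'_def setprod3_mult_image mult_map.span_image dim_mult_image[OF inv] by blast
  qed
qed

end
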